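(* Let $\mathbb{M}(n)$ be the algebra of complex $n\times n$ matrices, let $\varphi:\mathbb{M}(n)\to\mathbb{C}$ be a positive unital linear functional, and let $A\in\mathbb{M}(n)$ be Hermitian. Put $B=A-\varphi(A)I$. Then $$\operatorname{spd}(A)^2\ge 2\sqrt{\varphi(B^4)+3\varphi(B^2)^2}.$$
   Context: A linear functional $\varphi:\mathbb{M}(n)\to\mathbb{C}$ is called positive if $\varphi(X)\ge 0$ whenever $X$ is positive semidefinite, and unital if $\varphi(I)=1$, where $I$ is the identity matrix. $\operatorname{spd}(A)$ denotes the spread of $A$, i.e. $\operatorname{spd}(A)=\max_{i,j}|\lambda_i(A)-\lambda_j(A)|$ over the eigenvalues $\lambda_i(A)$ of $A$; for Hermitian $A$ it is the largest minus the smallest eigenvalue. For Hermitian $A$, the value $\varphi(A)$ is real. $\varphi(B^2)^2$ means $(\varphi(B^2))^2$. *)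

theory Defs
  imports
    "Jordan_Normal_Form.Schur_Decomposition"
    "Jordan_Normal_Form.Spectral_Radius"
begin

definition hermitian_mat :: "complex mat \<Rightarrow> bool" where
  "hermitian_mat A \<longleftrightarrow> square_mat A \<and> mat_adjoint A = A"

(* The order on complex is the one of Complex_Order: 0 \<le> z means that z is real and
   nonnegative. The second conjunct is v* X v \<ge> 0, as \<bullet>c conjugates its right argument. *)
definition psd_mat :: "complex mat \<Rightarrow> bool" where
  "psd_mat X \<longleftrightarrow> hermitian_mat X \<and>
     (\<forall>v \<in> carrier_vec (dim_row X). 0 \<le> (X *\<^sub>v v) \<bullet>c v)"

(* Functionals on n x n matrices are functions on the type of matrices of all sizes;
   their values outside carrier_mat n n are unconstrained. *)
definition linear_functional :: "nat \<Rightarrow> (complex mat \<Rightarrow> complex) \<Rightarrow> bool" where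
  "linear_functional n \<phi> \<longleftrightarrow>
     (\<forall>X \<in> carrier_mat n n. \<forall>Y \<in> carrier_mat n n. \<phi> (X + Y) = \<phi> X + \<phi> Y) \<and>
     (\<forall>c. \<forall>X \<in> carrier_mat n n. \<phi> (c \<cdot>\<^sub>m X) = c * \<phi> X)"

definition positive_functional :: "nat \<Rightarrow> (complex mat \<Rightarrow> complex) \<Rightarrow> bool" where
  "positive_functional n \<phi> \<longleftrightarrow> (\<forall>X \<in> carrier_mat n n. psd_mat X \<longrightarrow> 0 \<le> \<phi> X)"

definition unital_functional :: "nat \<Rightarrow> (complex mat \<Rightarrow> complex) \<Rightarrow> bool" where
  "unital_functional n \<phi> \<longleftrightarrow> \<phi> (1\<^sub>m n) = 1"

definition spd :: "complex mat \<Rightarrow> real" where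
  "spd A = Max {cmod (a - b) | a b. a \<in> spectrum A \<and> b \<in> spectrum A}"

end

theory Submission
  imports Defs
begin

text \<open>Diagonalizing \<open>A\<close> by a unitary turns \<open>f \<mapsto> \<phi> (f(A))\<close> into a positive unital functional \<open>L\<close>
  on functions on the spectrum. If \<open>x = \<lambda> - \<phi>(A)\<close> ranges over \<open>[-p, q]\<close>, then \<open>x\<^sup>2\<close> and \<open>x\<^sup>4\<close> lie
  below their chords over this interval; since \<open>L x = 0\<close>, the value of \<open>L\<close> on a chord is the
  chord's value at \<open>0\<close>. This gives \<open>\<phi>(B\<^sup>2) \<le> pq\<close> and \<open>\<phi>(B\<^sup>4) \<le> pq(p\<^sup>2 - pq + q\<^sup>2)\<close>, so that
  \<open>\<phi>(B\<^sup>4) + 3 \<phi>(B\<^sup>2)\<^sup>2 \<le> pq(p + q)\<^sup>2 \<le> (p + q)\<^sup>4 / 4\<close>, and \<open>p + q\<close> is the spread.\<close>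

section \<open>Adjoints and positive semidefinite matrices\<close>

lemma dim_mat_adjoint [simp]:
  "dim_row (mat_adjoint A) = dim_col A" "dim_col (mat_adjoint A) = dim_row A"
  by (simp_all add: mat_adjoint_def)

lemma mat_adjoint_carrier [simp, intro]:
  "A \<in> carrier_mat m n \<Longrightarrow> mat_adjoint A \<in> carrier_mat n m"
  by (auto intro: carrier_matI)

lemma index_mat_adjoint [simp]:
  "i < dim_col A \<Longrightarrow> j < dim_row A \<Longrightarrow> mat_adjoint A $$ (i, j) = conjugate (A $$ (j, i))"
  by (simp add: mat_adjoint_def mat_of_rows_def)

lemma mat_adjoint_adjoint [simp]: "mat_adjoint (mat_adjoint A) = A"
  by (rule eq_matI) auto

lemma mat_adjoint_mult:
  fixes A B :: "'a :: conjugatable_field mat"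
  assumes "A \<in> carrier_mat l m" "B \<in> carrier_mat m n"
  shows "mat_adjoint (A * B) = mat_adjoint B * mat_adjoint A"
  by (rule eq_matI)
     (use assms in \<open>auto simp: scalar_prod_def sum_conjugate conjugate_dist_mul mult.commute
        intro!: sum.cong\<close>)

lemma mat_adjoint_one [simp]: "mat_adjoint (1\<^sub>m n) = (1\<^sub>m n :: complex mat)"
  by (rule eq_matI) auto

lemma mat_adjoint_zero [simp]: "mat_adjoint (0\<^sub>m m n) = (0\<^sub>m n m :: complex mat)"
  by (rule eq_matI) auto

lemma mat_adjoint_four_block_mat:
  assumes "A \<in> carrier_mat nr1 nc1" "B \<in> carrier_mat nr1 nc2"
    "C \<in> carrier_mat nr2 nc1" "D \<in> carrier_mat nr2 nc2"
  shows "mat_adjoint (four_block_mat A B C D)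
    = four_block_mat (mat_adjoint A) (mat_adjoint C) (mat_adjoint B) (mat_adjoint D)"
  by (rule eq_matI) (use assms in auto)

lemma cscalar_prod_mult_mat_vec:
  fixes A :: "'a :: conjugatable_field mat"
  assumes A: "A \<in> carrier_mat m n" and u: "u \<in> carrier_vec n" and v: "v \<in> carrier_vec m"
  shows "(A *\<^sub>v u) \<bullet>c v = u \<bullet>c (mat_adjoint A *\<^sub>v v)"
proof -
  have "(A *\<^sub>v u) \<bullet>c v = (\<Sum>i<m. \<Sum>j<n. A $$ (i, j) * u $ j * conjugate (v $ i))"
    using assms by (auto simp: scalar_prod_def sum_distrib_right lessThan_atLeast0)
  also have "\<dots> = (\<Sum>j<n. \<Sum>i<m. A $$ (i, j) * u $ j * conjugate (v $ i))"
    by (rule sum.swap)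
  also have "\<dots> = u \<bullet>c (mat_adjoint A *\<^sub>v v)"
    using assms
    by (auto simp: scalar_prod_def sum_distrib_left lessThan_atLeast0 sum_conjugate
        conjugate_dist_mul ac_simps)
  finally show ?thesis .
qed

lemma hermitian_mat_iff:
  "A \<in> carrier_mat n n \<Longrightarrow> hermitian_mat A \<longleftrightarrow> mat_adjoint A = A"
  by (auto simp: hermitian_mat_def)

text \<open>The quadratic form of \<open>C * mat_adjoint C\<close> at \<open>v\<close> is the
  squared norm of \<open>mat_adjoint C *\<^sub>v v\<close>.\<close>

lemma psd_mat_mult_adjoint:
  assumes C: "C \<in> carrier_mat n n"
  shows "psd_mat (C * mat_adjoint C)"
  unfolding psd_mat_def
proof (intro conjI ballI)
  show "hermitian_mat (C * mat_adjoint C)"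
    using C by (subst hermitian_mat_iff[of _ n]) (auto simp: mat_adjoint_mult[of _ n n _ n])
next
  fix v :: "complex vec"
  assume "v \<in> carrier_vec (dim_row (C * mat_adjoint C))"
  then have v: "v \<in> carrier_vec n" using C by simp
  have "(C * mat_adjoint C *\<^sub>v v) \<bullet>c v = (C *\<^sub>v (mat_adjoint C *\<^sub>v v)) \<bullet>c v"
    using C v by (subst assoc_mult_mat_vec[of _ n n _ n]) auto
  also have "\<dots> = (mat_adjoint C *\<^sub>v v) \<bullet>c (mat_adjoint C *\<^sub>v v)"
    using C v
    by (subst cscalar_prod_mult_mat_vec[of C n n])
      (auto intro: mult_mat_vec_carrier[OF mat_adjoint_carrier[OF C]])
  finally show "0 \<le> (C * mat_adjoint C *\<^sub>v v) \<bullet>c v" by auto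
qed

section \<open>Unitary diagonalization of Hermitian matrices\<close>

lemma extend_to_unitary:
  fixes v :: "complex vec"
  assumes v: "v \<in> carrier_vec n" and v0: "v \<noteq> 0\<^sub>v n"
  obtains U c where "U \<in> carrier_mat n n" "mat_adjoint U * U = 1\<^sub>m n" "col U 0 = c \<cdot>\<^sub>v v"
proof -
  interpret cof_vec_space n "TYPE(complex)" .
  \<comment> \<open>The columns of \<open>U\<close> arise from a basis that starts with
    \<open>v\<close>, by orthogonalizing and then normalizing. Gram-Schmidt keeps the first vector,
    so the first column remains a multiple of \<open>v\<close>.\<close>
  define b where "b = basis_completion v"
  define ws where "ws = gram_schmidt n b"
  have n: "n \<noteq> 0" using v v0 by auto
  from basis_completion[OF v v0, folded b_def]
  have dist_b: "distinct b" and indep: "\<not> lin_dep (set b)" and b: "set b \<subseteq> carrier_vec n"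
    and hdb: "hd b = v" and len_b: "length b = n" by auto
  from hdb len_b n obtain vs where bv: "b = v # vs" by (cases b) auto
  from gram_schmidt_result[OF b dist_b indep refl, folded ws_def]
  have ws: "set ws \<subseteq> carrier_vec n" "corthogonal ws" "length ws = n"
    by (auto simp: len_b)
  have hdws: "hd ws = v"
    using gram_schmidt_hd[OF v, of vs] by (simp add: ws_def bv)
  have ws0: "ws ! 0 = v" using hdws ws(3) n by (cases ws) auto
  \<comment> \<open>\<open>c w\<close> is the inverse norm of \<open>w\<close>. The vectors in
    \<open>ws\<close> are orthogonal but not yet of length 1.\<close>
  define c :: "complex vec \<Rightarrow> complex" where "c w = 1 / of_real (sqrt (Re (w \<bullet>c w)))" for w
  define U where "U = mat n n (\<lambda>(i, j). c (ws ! j) * ws ! j $ i)"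
  have wsi: "ws ! i \<in> carrier_vec n" if "i < n" for i
    using that ws by auto
  have "mat_adjoint U * U = 1\<^sub>m n"
  proof (rule eq_matI)
    fix i j assume "i < dim_row (1\<^sub>m n :: complex mat)" "j < dim_col (1\<^sub>m n :: complex mat)"
    then have ij: "i < n" "j < n" by auto
    have "(mat_adjoint U * U) $$ (i, j)
      = (\<Sum>k<n. cnj (c (ws ! i)) * c (ws ! j) * (ws ! j $ k * cnj (ws ! i $ k)))"
      using ij by (auto simp: U_def scalar_prod_def lessThan_atLeast0 intro!: sum.cong)
    also have "\<dots> = cnj (c (ws ! i)) * c (ws ! j) * (ws ! j \<bullet>c ws ! i)"
      using ij wsi[of i] wsi[of j]
      by (auto simp: scalar_prod_def sum_distrib_left lessThan_atLeast0 intro!: sum.cong)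
    also have "\<dots> = (if i = j then 1 else 0)"
    proof (cases "i = j")
      case False
      then have "ws ! j \<bullet>c ws ! i = 0"
        using corthogonalD[OF ws(2), of j i] ij ws(3) by auto
      then show ?thesis using False by simp
    next
      case True
      define r where "r = Re (ws ! j \<bullet>c ws ! j)"
      have "0 \<le> ws ! j \<bullet>c ws ! j" by auto
      then have r: "ws ! j \<bullet>c ws ! j = of_real r" "0 \<le> r"
        by (auto simp: r_def less_eq_complex_def complex_eq_iff)
      have "ws ! j \<bullet>c ws ! j \<noteq> 0"
        using corthogonalD[OF ws(2), of j j] ij ws(3) by auto
      then have "0 < r" using r by auto
      moreover have "c (ws ! j) = of_real (1 / sqrt r)" by (simp add: c_def r_def)
      ultimately show ?thesis using True r
        by (simp flip: of_real_mult)
    qed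
    finally show "(mat_adjoint U * U) $$ (i, j) = 1\<^sub>m n $$ (i, j)"
      using ij by simp
  qed (auto simp: U_def)
  moreover have "col U 0 = c v \<cdot>\<^sub>v v"
    using n v by (auto simp: U_def ws0)
  moreover have "U \<in> carrier_mat n n" by (simp add: U_def)
  ultimately show ?thesis using that by blast
qed

text \<open>Induction on the dimension by deflation: conjugating with a unitary whose first column
  is an eigenvector splits off a block of size 1, and the remaining block is again Hermitian. The
  diagonal is only known to be complex during the induction; its reality follows afterwards from
  \<open>A\<close> being Hermitian.\<close>

lemma hermitian_mat_unitary_diagonalization:
  assumes "A \<in> carrier_mat n n" "hermitian_mat A"
  obtains P d where "P \<in> carrier_mat n n" "mat_adjoint P * P = 1\<^sub>m n"
    "A = P * mat_diag n (\<lambda>i. complex_of_real (d i)) * mat_adjoint P"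
proof -
  have "\<exists>P d. P \<in> carrier_mat n n \<and> mat_adjoint P * P = 1\<^sub>m n \<and>
    A = P * mat_diag n d * mat_adjoint P"
    using assms
  proof (induction n arbitrary: A)
    case 0
    then show ?case by (intro exI[of _ "1\<^sub>m 0"] exI[of _ "\<lambda>_. 0"]) (auto intro!: eq_matI)
  next
    case (Suc m)
    note A = Suc.prems(1)
    have adjA: "mat_adjoint A = A" using Suc.prems by (simp add: hermitian_mat_def)
    obtain e where "eigenvalue A e"
      using spectrum_non_empty[OF A] by (auto simp: spectrum_def)
    then obtain v where v: "v \<in> carrier_vec (Suc m)" "v \<noteq> 0\<^sub>v (Suc m)" "A *\<^sub>v v = e \<cdot>\<^sub>v v"
      using A by (auto simp: eigenvalue_def eigenvector_def)
    obtain U c where U: "U \<in> carrier_mat (Suc m) (Suc m)"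
      and UU: "mat_adjoint U * U = 1\<^sub>m (Suc m)" and U0: "col U 0 = c \<cdot>\<^sub>v v"
      using extend_to_unitary[OF v(1,2)] by metis
    have UU': "U * mat_adjoint U = 1\<^sub>m (Suc m)"
      by (rule mat_mult_left_right_inverse[OF _ U UU]) (use U in auto)
    define H where "H = mat_adjoint U * (A * U)"
    have H: "H \<in> carrier_mat (Suc m) (Suc m)" using U A by (auto simp: H_def)
    have adjH: "mat_adjoint H = H"
      using U A adjA
      by (simp add: H_def mat_adjoint_mult[of _ "Suc m" "Suc m" _ "Suc m"]
          assoc_mult_mat[of _ "Suc m" "Suc m" _ "Suc m" _ "Suc m"])
    \<comment> \<open>The first column of \<open>U\<close> is scaled by \<open>e\<close> under
      \<open>A\<close>, so the first column of \<open>H\<close> is \<open>e\<close> times that of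
      \<open>mat_adjoint U * U\<close>, the identity.\<close>
    have "col (A * U) 0 = c \<cdot>\<^sub>v (A *\<^sub>v v)"
      by (simp add: col_mult2[OF A U] U0 mult_mat_vec[OF A v(1)])
    also have "\<dots> = e \<cdot>\<^sub>v col U 0"
      by (simp add: v(3) U0 smult_smult_assoc mult.commute)
    finally have "col (A * U) 0 = e \<cdot>\<^sub>v col U 0" .
    moreover have "col U 0 \<in> carrier_vec (Suc m)" using v by (simp add: U0)
    ultimately have "col H 0 = e \<cdot>\<^sub>v col (mat_adjoint U * U) 0"
      using A U by (simp add: H_def col_mult2[of _ "Suc m" "Suc m" _ "Suc m"]
          mult_mat_vec[OF mat_adjoint_carrier[OF U]])
    then have col0: "H $$ (i, 0) = (if i = 0 then e else 0)" if "i < Suc m" for i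
      using that H UU by (auto simp: vec_eq_iff)
    \<comment> \<open>Since \<open>H\<close> is Hermitian, the zeros of its first column reappear in
      its first row; this makes \<open>H\<close> block diagonal.\<close>
    have row0: "H $$ (0, j) = 0" if "0 < j" "j < Suc m" for j
      using col0[of j] that H adjH index_mat_adjoint[of 0 H j] by auto
    define K where "K = mat m m (\<lambda>(i, j). H $$ (Suc i, Suc j))"
    have K: "K \<in> carrier_mat m m" by (simp add: K_def)
    have HK: "H = four_block_mat (mat 1 1 (\<lambda>_. e)) (0\<^sub>m 1 m) (0\<^sub>m m 1) K"
      by (rule eq_matI) (use H col0 row0 in \<open>auto simp: K_def\<close>)
    have "hermitian_mat K"
      unfolding hermitian_mat_iff[OF K]
    proof (rule eq_matI)
      fix i j assume "i < dim_row K" "j < dim_col K"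
      then show "mat_adjoint K $$ (i, j) = K $$ (i, j)"
        using H index_mat_adjoint[of "Suc i" H "Suc j"] adjH by (auto simp: K_def)
    qed (auto simp: K_def)
    then obtain Q d where Q: "Q \<in> carrier_mat m m" "mat_adjoint Q * Q = 1\<^sub>m m"
      and KQ: "K = Q * mat_diag m d * mat_adjoint Q"
      using Suc.IH[OF K] by blast
    \<comment> \<open>\<open>V\<close> borders the unitary \<open>Q\<close> of the smaller block by
      a 1, leaving the split-off entry \<open>e\<close> untouched. Hence \<open>U * V\<close>
      diagonalizes \<open>A\<close>, with \<open>e\<close> placed in front of the entries
      \<open>d\<close>.\<close>
    define V where "V = four_block_mat (1\<^sub>m 1) (0\<^sub>m 1 m) (0\<^sub>m m 1) Q"
    have V: "V \<in> carrier_mat (Suc m) (Suc m)"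
      using Q by (auto simp: V_def)
    have adjV: "mat_adjoint V = four_block_mat (1\<^sub>m 1) (0\<^sub>m 1 m) (0\<^sub>m m 1) (mat_adjoint Q)"
      unfolding V_def using Q by (subst mat_adjoint_four_block_mat[of _ 1 1 _ m _ m]) auto
    have one: "1\<^sub>m (Suc m) = four_block_mat (1\<^sub>m 1) (0\<^sub>m 1 m) (0\<^sub>m m 1) (1\<^sub>m m)"
      by (rule eq_matI) auto
    have VV: "mat_adjoint V * V = 1\<^sub>m (Suc m)"
      unfolding adjV one unfolding V_def
      using Q by (subst mult_four_block_mat[of _ 1 1 _ m _ m _ _ 1 _ m]) auto
    define f where "f = case_nat e d"
    have diag: "mat_diag (Suc m) f
      = four_block_mat (mat 1 1 (\<lambda>_. e)) (0\<^sub>m 1 m) (0\<^sub>m m 1) (mat_diag m d)"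
      by (rule eq_matI) (auto simp: mat_diag_def f_def split: nat.splits)
    have "V * mat_diag (Suc m) f
      = four_block_mat (mat 1 1 (\<lambda>_. e)) (0\<^sub>m 1 m) (0\<^sub>m m 1) (Q * mat_diag m d)"
      unfolding V_def diag
      using Q by (subst mult_four_block_mat[of _ 1 1 _ m _ m _ _ 1 _ m])
        (auto simp: left_mult_zero_mat[OF mat_diag_dim])
    then have HV: "V * mat_diag (Suc m) f * mat_adjoint V = H"
      unfolding adjV HK KQ
      using Q mult_carrier_mat[OF Q(1) mat_diag_dim[of m d]]
      by (simp, subst mult_four_block_mat[of _ 1 1 _ m _ m _ _ 1 _ m])
        (auto simp: right_mult_zero_mat[of _ m m]
          left_add_zero_mat[OF mult_carrier_mat[OF mult_carrier_mat[OF Q(1) mat_diag_dim]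
              mat_adjoint_carrier[OF Q(1)]]])
    let ?N = "Suc m"
    note assoc = assoc_mult_mat[of _ ?N ?N _ ?N _ ?N] mult_carrier_mat[of _ ?N ?N _ ?N]
    have aU: "mat_adjoint U \<in> carrier_mat ?N ?N" and aV: "mat_adjoint V \<in> carrier_mat ?N ?N"
      using U V by auto
    have adjUV: "mat_adjoint (U * V) = mat_adjoint V * mat_adjoint U"
      by (rule mat_adjoint_mult[OF U V])
    have "A = (U * mat_adjoint U) * A * (U * mat_adjoint U)"
      using A by (simp add: UU')
    also have "\<dots> = U * H * mat_adjoint U"
      using A U aU by (simp add: H_def assoc)
    also have "\<dots> = U * V * mat_diag ?N f * mat_adjoint (U * V)"
      unfolding HV[symmetric] adjUV using U V aU aV mat_diag_dim[of ?N f] by (simp add: assoc)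
    finally have AUV: "A = U * V * mat_diag ?N f * mat_adjoint (U * V)" .
    have "mat_adjoint (U * V) * (U * V) = mat_adjoint V * ((mat_adjoint U * U) * V)"
      unfolding adjUV using U V aU aV by (simp add: assoc)
    also have "\<dots> = 1\<^sub>m ?N" using U V by (simp add: UU VV)
    finally show ?case using AUV U V by (intro exI[of _ "U * V"] exI[of _ f]) auto
  qed
  then obtain P d where P: "P \<in> carrier_mat n n" and PP: "mat_adjoint P * P = 1\<^sub>m n"
    and AP: "A = P * mat_diag n d * mat_adjoint P" by blast
  let ?D = "mat_diag n d"
  have D: "?D \<in> carrier_mat n n" by simp
  have aP: "mat_adjoint P \<in> carrier_mat n n" using P by simp
  note assoc = assoc_mult_mat[of _ n n _ n _ n] mult_carrier_mat[of _ n n _ n]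
  \<comment> \<open>Solving for the diagonal matrix exhibits it as a unitary conjugate of
    \<open>A\<close>, hence as Hermitian, so its diagonal entries equal their conjugates.\<close>
  have "mat_adjoint P * A * P = (mat_adjoint P * P) * ?D * (mat_adjoint P * P)"
    using P D aP by (simp add: AP assoc)
  then have "?D = mat_adjoint P * A * P"
    by (simp add: PP left_mult_one_mat[OF mat_diag_dim] right_mult_one_mat[OF mat_diag_dim])
  moreover have "mat_adjoint (mat_adjoint P * A * P) = mat_adjoint P * A * P"
    using P aP assms by (simp add: hermitian_mat_def mat_adjoint_mult[of _ n n _ n] assoc)
  ultimately have "mat_adjoint ?D = ?D" by simp
  then have "cnj (d i) = d i" if "i < n" for i
    using that index_mat_adjoint[of i ?D i] by (simp add: mat_diag_def)
  then have "?D = mat_diag n (\<lambda>i. complex_of_real (Re (d i)))"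
    by (intro eq_matI) (auto simp: mat_diag_def complex_eq_iff)
  with AP show ?thesis using that[OF P PP] by metis
qed

section \<open>Spectrum, powers and positivity of diagonalized matrices\<close>

lemma similar_mat_diag_in_spectrum:
  fixes f :: "nat \<Rightarrow> 'a :: field"
  assumes sim: "similar_mat_wit A (mat_diag n f) P Q" and i: "i < n"
  shows "f i \<in> spectrum A"
proof -
  have "dim_row A = n"
    using carrier_matD(1)[OF similar_mat_witD(5)[OF refl sim]] by (simp add: mat_diag_def)
  then have A: "A \<in> carrier_mat n n"
    using similar_mat_witD(4)[OF refl sim] by metis
  \<comment> \<open>Similar matrices share their characteristic polynomial, and that of a triangular
    matrix splits with the diagonal entries as roots.\<close>
  have "upper_triangular (mat_diag n f)"
    by (auto simp: mat_diag_def upper_triangular_def)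
  then have "char_poly (mat_diag n f) = (\<Prod>a\<leftarrow>diag_mat (mat_diag n f). [:- a, 1:])"
    by (rule char_poly_upper_triangular[OF mat_diag_dim])
  moreover have "char_poly A = char_poly (mat_diag n f)"
    using sim by (intro char_poly_similar) (auto simp: similar_mat_def)
  moreover have "f i \<in> set (diag_mat (mat_diag n f))"
    using i by (auto simp: diag_mat_def mat_diag_def)
  ultimately have "poly (char_poly A) (f i) = 0"
    by (simp add: poly_prod_list prod_list_zero_iff)
  then show ?thesis by (simp add: spectrum_root_char_poly[OF A])
qed

lemma mat_diag_pow: "mat_diag n f ^\<^sub>m k = mat_diag n (\<lambda>i. f i ^ k :: 'a :: comm_semiring_1)"
proof (induction k)
  case 0
  then show ?case by (simp add: carrier_matD[OF mat_diag_dim])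
next
  case (Suc k)
  then show ?case by (simp add: mult.commute)
qed

text \<open>The diagonal matrix has a real diagonal square root \<open>S\<close>, so the product is
  \<open>C * mat_adjoint C\<close> for \<open>C = P * S\<close>.\<close>

lemma psd_mat_unitary_conj_diag:
  assumes P: "P \<in> carrier_mat n n" and f: "\<And>i. i < n \<Longrightarrow> 0 \<le> f i"
  shows "psd_mat (P * mat_diag n (\<lambda>i. complex_of_real (f i)) * mat_adjoint P)"
proof -
  define S where "S = mat_diag n (\<lambda>i. complex_of_real (sqrt (f i)))"
  have S: "S \<in> carrier_mat n n" by (simp add: S_def)
  have "mat_adjoint S = S" by (rule eq_matI) (auto simp: S_def mat_diag_def)
  moreover have "mat_diag n (\<lambda>i. complex_of_real (f i)) = S * S"
    unfolding S_def mat_diag_diag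
    using f by (auto simp: mat_diag_def simp flip: of_real_mult intro!: eq_matI)
  ultimately have "P * mat_diag n (\<lambda>i. complex_of_real (f i)) * mat_adjoint P
    = (P * S) * mat_adjoint (P * S)"
    using P S by (simp add: mat_adjoint_mult[of _ n n _ n] assoc_mult_mat[of _ n n _ n _ n])
  then show ?thesis using psd_mat_mult_adjoint[of "P * S" n] P S by simp
qed

section \<open>Moment inequality for a positive unital functional on real functions\<close>

lemma positive_linear_moment_bound:
  fixes L :: "('i \<Rightarrow> real) \<Rightarrow> real"
  assumes add: "\<And>f g. L (\<lambda>i. f i + g i) = L f + L g"
    and scale: "\<And>c f. L (\<lambda>i. c * f i) = c * L f"
    and pos: "\<And>f. (\<And>i. i \<in> I \<Longrightarrow> 0 \<le> f i) \<Longrightarrow> 0 \<le> L f"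
    and one: "L (\<lambda>_. 1) = 1"
    and bounds: "\<And>i. i \<in> I \<Longrightarrow> a \<le> d i" "\<And>i. i \<in> I \<Longrightarrow> d i \<le> b"
    and m: "m = L d"
  shows "L (\<lambda>i. (d i - m) ^ 4) + 3 * (L (\<lambda>i. (d i - m)\<^sup>2))\<^sup>2 \<le> ((b - a)\<^sup>2 / 2)\<^sup>2"
proof -
  \<comment> \<open>\<open>L\<close> behaves like an expectation and \<open>d\<close> like a random
    variable with mean \<open>m\<close> and values in \<open>[a, b]\<close>. Constants are
    reproduced because \<open>L\<close> sends 1 to 1.\<close>
  have affine: "L (\<lambda>i. u * f i + v) = u * L f + v" for u v f
    using add[of "\<lambda>i. u * f i" "\<lambda>i. v * 1"] scale[of u f] scale[of v "\<lambda>_. 1"] one by simp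
  have mono: "L f \<le> L g" if "\<And>i. i \<in> I \<Longrightarrow> f i \<le> g i" for f g
  proof -
    have "0 \<le> L (\<lambda>i. g i + (-1) * f i)" using that by (intro pos) simp
    then show ?thesis unfolding add scale by simp
  qed
  define x where "x i = d i - m" for i
  define p q where "p = m - a" and "q = b - m"
  have x0: "L (\<lambda>i. u * x i + v) = v" for u v
    using affine[of u d "v - u * m"] m by (simp add: x_def algebra_simps)
  have x: "- p \<le> x i" "x i \<le> q" if "i \<in> I" for i
    using bounds that by (auto simp: x_def p_def q_def)
  \<comment> \<open>The mean lies between the bounds. The constants \<open>a\<close> and
    \<open>b\<close> are written as affine functions of \<open>d\<close> so that
    \<open>affine\<close> evaluates them.\<close>
  have "0 \<le> p" "0 \<le> q"
    using mono[of "\<lambda>i. 0 * d i + a" d] mono[of d "\<lambda>i. 0 * d i + b"] bounds m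
    unfolding affine by (auto simp: p_def q_def)
  have sq: "L (\<lambda>i. (x i)\<^sup>2) \<le> p * q"
  proof -
    \<comment> \<open>This is \<open>(q - x i) * (x i + p) \<ge> 0\<close> expanded; the right side
      is the chord of the square over \<open>[-p, q]\<close>.\<close>
    have "(x i)\<^sup>2 \<le> (q - p) * x i + p * q" if "i \<in> I" for i
      using mult_nonneg_nonneg[of "q - x i" "x i + p"] x[OF that]
      by (simp add: algebra_simps power2_eq_square)
    then have "L (\<lambda>i. (x i)\<^sup>2) \<le> L (\<lambda>i. (q - p) * x i + p * q)" by (rule mono)
    then show ?thesis unfolding x0 .
  qed
  have four: "L (\<lambda>i. x i ^ 4) \<le> p * q * (p\<^sup>2 - p * q + q\<^sup>2)"
  proof -
    have "x i ^ 4 \<le> (q - p) * (p\<^sup>2 + q\<^sup>2) * x i + p * q * (p\<^sup>2 - p * q + q\<^sup>2)" if "i \<in> I" for i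
    proof -
      \<comment> \<open>The chord minus the fourth power vanishes at \<open>-p\<close> and
        \<open>q\<close>, which gives the two linear factors. The remaining quadratic
        \<open>x\<^sup>2 + (q - p) * x + p\<^sup>2 - p * q + q\<^sup>2\<close> is written as a sum
        of squares with nonnegative weights.\<close>
      have "(q - p) * (p\<^sup>2 + q\<^sup>2) * x i + p * q * (p\<^sup>2 - p * q + q\<^sup>2) - x i ^ 4
        = (q - x i) * (x i + p) * ((x i + (q - p) / 2)\<^sup>2 + (p\<^sup>2 + q\<^sup>2) / 2 + ((p - q) / 2)\<^sup>2)"
        by (simp add: field_simps power2_eq_square power4_eq_xxxx)
      moreover have "0 \<le> (q - x i) * (x i + p)"
        using x[OF that] by (intro mult_nonneg_nonneg) auto
      moreover have "0 \<le> (x i + (q - p) / 2)\<^sup>2 + (p\<^sup>2 + q\<^sup>2) / 2 + ((p - q) / 2)\<^sup>2"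
        by simp
      ultimately show ?thesis
        by (metis diff_ge_0_iff_ge mult_nonneg_nonneg)
    qed
    then have "L (\<lambda>i. x i ^ 4)
        \<le> L (\<lambda>i. (q - p) * (p\<^sup>2 + q\<^sup>2) * x i + p * q * (p\<^sup>2 - p * q + q\<^sup>2))"
      by (rule mono)
    then show ?thesis unfolding x0 .
  qed
  have "0 \<le> L (\<lambda>i. (x i)\<^sup>2)" by (intro pos) simp
  with sq have "(L (\<lambda>i. (x i)\<^sup>2))\<^sup>2 \<le> (p * q)\<^sup>2" by (rule power_mono)
  with four have "L (\<lambda>i. x i ^ 4) + 3 * (L (\<lambda>i. (x i)\<^sup>2))\<^sup>2
      \<le> p * q * (p\<^sup>2 - p * q + q\<^sup>2) + 3 * (p * q)\<^sup>2" by simp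
  \<comment> \<open>The coefficient 3 turns \<open>p\<^sup>2 - p * q + q\<^sup>2\<close> into the
    perfect square \<open>(p + q)\<^sup>2\<close>. The inequality of arithmetic and geometric means
    then bounds the factor \<open>p * q\<close>.\<close>
  also have "\<dots> = (p * q) * (p + q)\<^sup>2" by (simp add: algebra_simps power2_eq_square)
  also have "p * q \<le> (p + q)\<^sup>2 / 4"
    using zero_le_power2[of "p - q"] by (simp add: power2_sum power2_diff)
  then have "(p * q) * (p + q)\<^sup>2 \<le> ((p + q)\<^sup>2 / 4) * (p + q)\<^sup>2"
    by (rule mult_right_mono) simp
  also have "\<dots> = ((b - a)\<^sup>2 / 2)\<^sup>2" by (simp add: p_def q_def power2_eq_square)
  finally show ?thesis by (simp add: x_def)
qed

section \<open>Transfer of the moment inequality to the matrix functional\<close>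

theorem theorem3p5:
  fixes n :: nat and \<phi> :: "complex mat \<Rightarrow> complex" and A B :: "complex mat"
  assumes "linear_functional n \<phi>"
    and "positive_functional n \<phi>"
    and "unital_functional n \<phi>"
    and "A \<in> carrier_mat n n"
    and "hermitian_mat A"
    and "B = A - \<phi> A \<cdot>\<^sub>m 1\<^sub>m n"
  shows "(spd A)\<^sup>2 \<ge> 2 * sqrt (Re (\<phi> (B ^\<^sub>m 4) + 3 * (\<phi> (B ^\<^sub>m 2))\<^sup>2))"
proof -
  note A = assms(4)
  have lin: "\<phi> (X + Y) = \<phi> X + \<phi> Y" "\<phi> (c \<cdot>\<^sub>m X) = c * \<phi> X"
    if "X \<in> carrier_mat n n" "Y \<in> carrier_mat n n" for X Y c
    using assms(1) that by (auto simp: linear_functional_def)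
  \<comment> \<open>In dimension 0 the identity equals 0 times itself, so linearity would give it
    the value 0 instead of 1. Positive dimension makes the \<open>Min\<close> and \<open>Max\<close>
    of the eigenvalues below meaningful.\<close>
  have n: "n \<noteq> 0"
  proof
    assume "n = 0"
    then have "0 \<cdot>\<^sub>m 1\<^sub>m n = (1\<^sub>m n :: complex mat)" by (auto intro: eq_matI)
    with lin(2)[of "1\<^sub>m n" "1\<^sub>m n" 0] assms(3) show False by (simp add: unital_functional_def)
  qed
  obtain P d where P: "P \<in> carrier_mat n n" and PP: "mat_adjoint P * P = 1\<^sub>m n"
    and AP: "A = P * mat_diag n (\<lambda>i. complex_of_real (d i)) * mat_adjoint P"
    using hermitian_mat_unitary_diagonalization[OF A assms(5)] by metis
  have PP': "P * mat_adjoint P = 1\<^sub>m n"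
    by (rule mat_mult_left_right_inverse[OF _ P PP]) (use P in auto)
  \<comment> \<open>\<open>M\<close> is the functional calculus of \<open>A\<close>, with
    \<open>f\<close> a function of the index of an eigenvalue instead of the eigenvalue itself. The
    composite of \<open>M\<close>, \<open>\<phi>\<close> and \<open>Re\<close> is the
    \<open>L\<close> of the moment inequality.\<close>
  define M where "M f = P * mat_diag n (\<lambda>i. complex_of_real (f i)) * mat_adjoint P" for f
  have M_index: "M f $$ (i, j) = (\<Sum>k<n. P $$ (i, k) * of_real (f k) * cnj (P $$ (j, k)))"
    if "i < n" "j < n" for f i j
    using P that
    by (simp add: M_def mat_diag_mult_right[OF P] scalar_prod_def lessThan_atLeast0)
  have M: "M f \<in> carrier_mat n n" for f
    using P mult_carrier_mat[OF mult_carrier_mat[OF P mat_diag_dim] mat_adjoint_carrier[OF P]]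
    by (simp add: M_def)
  have M_add: "M (\<lambda>i. f i + g i) = M f + M g" for f g
    by (rule eq_matI)
      (use M[of f] M[of g] M[of "\<lambda>i. f i + g i"] in
        \<open>simp_all add: M_index algebra_simps sum.distrib\<close>)
  have M_scale: "M (\<lambda>i. c * f i) = of_real c \<cdot>\<^sub>m M f" for c f
    by (rule eq_matI)
      (use M[of f] M[of "\<lambda>i. c * f i"] in \<open>simp_all add: M_index sum_distrib_left ac_simps\<close>)
  have M_one: "M (\<lambda>_. 1) = 1\<^sub>m n"
    using P by (simp add: M_def PP')
  have sim: "similar_mat_wit (M f) (mat_diag n (\<lambda>i. complex_of_real (f i))) P (mat_adjoint P)" for f
    by (rule similar_mat_witI[of _ _ n]) (use P M PP PP' in \<open>auto simp: M_def\<close>)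
  have M_pow: "M f ^\<^sub>m k = M (\<lambda>i. f i ^ k)" for f k
    using similar_mat_wit_pow_id[OF sim, of f k] by (simp add: mat_diag_pow M_def)
  have phi_add: "\<phi> (M (\<lambda>i. f i + g i)) = \<phi> (M f) + \<phi> (M g)" for f g
    by (simp add: M_add lin M)
  have phi_scale: "\<phi> (M (\<lambda>i. c * f i)) = of_real c * \<phi> (M f)" for c f
    using lin(2)[OF M M] by (simp add: M_scale)
  have phi_one: "\<phi> (M (\<lambda>_. 1)) = 1"
    using assms(3) by (simp add: M_one unital_functional_def)
  have phi_pos: "0 \<le> \<phi> (M f)" if "\<And>i. i < n \<Longrightarrow> 0 \<le> f i" for f
    using assms(2) M[of f] psd_mat_unitary_conj_diag[OF P, of f] that
    by (auto simp: positive_functional_def M_def)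
  have Ad: "A = M d" by (simp add: M_def AP)
  have dspec: "complex_of_real (d i) \<in> spectrum A" if "i < n" for i
    using similar_mat_diag_in_spectrum[OF sim that, of d] by (simp add: Ad)
  define a b where "a = Min (d ` {..<n})" and "b = Max (d ` {..<n})"
  have bounds: "a \<le> d i" "d i \<le> b" if "i \<in> {..<n}" for i
    using that by (auto simp: a_def b_def)
  have "a \<in> d ` {..<n}" "b \<in> d ` {..<n}"
    using n by (auto simp: a_def b_def lessThan_empty_iff intro!: Min_in Max_in)
  then have ab: "complex_of_real a \<in> spectrum A" "complex_of_real b \<in> spectrum A"
    using dspec by auto
  have ba: "b - a \<le> spd A"
  proof -
    \<comment> \<open>Rewriting the set as an image of a finite product shows that the
      \<open>Max\<close> in \<open>spd\<close> ranges over a finite set, so each of its members is a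
      lower bound for \<open>spd A\<close>.\<close>
    have "{cmod (x - y) | x y. x \<in> spectrum A \<and> y \<in> spectrum A}
      = (\<lambda>(x, y). cmod (x - y)) ` (spectrum A \<times> spectrum A)" by auto
    then have "finite {cmod (x - y) | x y. x \<in> spectrum A \<and> y \<in> spectrum A}"
      using card_finite_spectrum(1)[OF A] by simp
    then have "cmod (complex_of_real b - complex_of_real a) \<le> spd A"
      unfolding spd_def using ab by (intro Max_ge) auto
    then show ?thesis by (simp flip: of_real_diff)
  qed
  define m where "m = Re (\<phi> A)"
  \<comment> \<open>\<open>b\<close> times the identity minus \<open>A\<close> is positive
    semidefinite, so its value under \<open>\<phi>\<close> is nonnegative in the order on
    \<open>complex\<close>. This includes a vanishing imaginary part, and therefore
    \<open>\<phi> A\<close> is real.\<close>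
  have "0 \<le> \<phi> (M (\<lambda>i. b * 1 + (-1) * d i))"
    by (rule phi_pos) (use bounds in auto)
  then have "0 \<le> of_real b - \<phi> A"
    unfolding phi_add phi_scale phi_one by (simp add: Ad)
  then have phiA: "\<phi> A = of_real m"
    by (simp add: m_def complex_eq_iff less_eq_complex_def)
  have "B = A + of_real (- m) \<cdot>\<^sub>m 1\<^sub>m n"
    using A by (auto simp: assms(6) phiA intro!: eq_matI)
  then have "B = M (\<lambda>i. d i + (- m) * 1)"
    unfolding M_add M_scale M_one Ad .
  then have B_pow: "B ^\<^sub>m k = M (\<lambda>i. (d i - m) ^ k)" for k
    by (simp add: M_pow)
  \<comment> \<open>For every complex \<open>z\<close>, \<open>Re (z\<^sup>2) = (Re z)\<^sup>2 - (Im
    z)\<^sup>2 \<le> (Re z)\<^sup>2\<close>.\<close>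
  have "Re (\<phi> (B ^\<^sub>m 4) + 3 * (\<phi> (B ^\<^sub>m 2))\<^sup>2) \<le> Re (\<phi> (B ^\<^sub>m 4)) + 3 * (Re (\<phi> (B ^\<^sub>m 2)))\<^sup>2"
    by (simp add: power2_eq_square)
  also have "\<dots> \<le> ((b - a)\<^sup>2 / 2)\<^sup>2"
    unfolding B_pow
    by (rule positive_linear_moment_bound[where L = "\<lambda>f. Re (\<phi> (M f))" and I = "{..<n}"])
      (use phi_pos bounds in \<open>auto simp: phi_add phi_scale phi_one m_def Ad less_eq_complex_def\<close>)
  finally have "sqrt (Re (\<phi> (B ^\<^sub>m 4) + 3 * (\<phi> (B ^\<^sub>m 2))\<^sup>2)) \<le> (b - a)\<^sup>2 / 2"
    by (intro real_le_lsqrt) auto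
  \<comment> \<open>Squaring \<open>ba\<close> requires \<open>a \<le> b\<close>, which comes from
    the bounds at index 0.\<close>
  moreover have "(b - a)\<^sup>2 \<le> (spd A)\<^sup>2"
    using ba bounds[of 0] n by (intro power_mono) auto
  ultimately show ?thesis by simp
qed

end
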